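(* Let $m$ and $n$ be non-negative integers and let $G$ be a locally graded group having exactly $m$ subgroups that are not nilpotent of class at most $n$. Then $G$ has a normal subgroup $S$ which is soluble of derived length at most $[\log_2(n)]+m+3$ such that $G/S$ is finite of order at most $m!$.
   Context: A group $G$ is locally graded if every non-trivial finitely generated subgroup of $G$ has a non-trivial finite homomorphic image. $[x]$ denotes the integer part of $x$. A subgroup is "not nilpotent of class at most $n$" if it is either non-nilpotent or nilpotent of class greater than $n$. *)

theory Defs
  imports Complex_Main "HOL-Algebra.Algebra"
begin

definition comm_subgroup :: "('a, 'b) monoid_scheme \<Rightarrow> 'a set \<Rightarrow> 'a set \<Rightarrow> 'a set" where
  "comm_subgroup G A B = generate G
     {a \<otimes>\<^bsub>G\<^esub> b \<otimes>\<^bsub>G\<^esub> inv\<^bsub>G\<^esub> a \<otimes>\<^bsub>G\<^esub> inv\<^bsub>G\<^esub> b | a b. a \<in> A \<and> b \<in> B}"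

text \<open>Lower central series of a subgroup H of G:
  lower_central G H i is gamma_(i+1)(H), so gamma_1(H) = H and gamma_(i+2)(H) = [gamma_(i+1)(H), H].\<close>
fun lower_central :: "('a, 'b) monoid_scheme \<Rightarrow> 'a set \<Rightarrow> nat \<Rightarrow> 'a set" where
  "lower_central G H 0 = H"
| "lower_central G H (Suc i) = comm_subgroup G (lower_central G H i) H"

definition nilpotent_class_le :: "('a, 'b) monoid_scheme \<Rightarrow> 'a set \<Rightarrow> nat \<Rightarrow> bool" where
  "nilpotent_class_le G H n \<longleftrightarrow> lower_central G H n = {\<one>\<^bsub>G\<^esub>}"

definition has_nontrivial_finite_image :: "('a, 'b) monoid_scheme \<Rightarrow> 'a set \<Rightarrow> bool" where
  "has_nontrivial_finite_image G H \<longleftrightarrow>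
     (\<exists>N. N \<lhd> G\<lparr>carrier := H\<rparr> \<and> N \<noteq> H \<and> finite (rcosets\<^bsub>G\<lparr>carrier := H\<rparr>\<^esub> N))"

definition locally_graded :: "('a, 'b) monoid_scheme \<Rightarrow> bool" where
  "locally_graded G \<longleftrightarrow>
     (\<forall>A. finite A \<and> A \<subseteq> carrier G \<and> generate G A \<noteq> {\<one>\<^bsub>G\<^esub>}
          \<longrightarrow> has_nontrivial_finite_image G (generate G A))"

end

theory Submission
  imports Defs
begin

text \<open>Let \<open>K\<close> be the intersection of the normalizers of the \<open>m\<close> subgroups that are not nilpotent of
  class at most \<open>n\<close>; conjugation embeds \<open>G/K\<close> into the symmetric group on them. If \<open>K\<close> is itself such
  a subgroup, let \<open>H \<le> K\<close> be a minimal one. Every subgroup of \<open>K\<close> containing \<open>H\<close> is normal in \<open>K\<close>, so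
  \<open>K/H\<close> is a Dedekind group and \<open>K'' \<le> H\<close>. Nilpotency of class at most \<open>n\<close> is a local property, so
  \<open>H\<close> is finitely generated and has a nontrivial finite image; as all proper subgroups of that image
  are nilpotent, it is not perfect (Schmidt). Hence \<open>H'\<close> is contained in a proper subgroup of \<open>H\<close>,
  which is nilpotent of class at most \<open>n\<close> and so has derived length at most \<open>[log n] + 1\<close>.\<close>

section \<open>The lower central series\<close>

context group
begin

abbreviation commutator :: "'a \<Rightarrow> 'a \<Rightarrow> 'a" where
  "commutator a b \<equiv> a \<otimes> b \<otimes> inv a \<otimes> inv b"

text \<open>With \<open>m_assoc\<close> and \<open>inv_mult_group\<close> this lets the simplifier
  reduce words in group elements and their inverses, which settles the commutator identities
  below.\<close>

lemma mult_inv_cancel_left [simp]: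
  assumes "x \<in> carrier G" "y \<in> carrier G"
  shows "x \<otimes> (inv x \<otimes> y) = y" and "inv x \<otimes> (x \<otimes> y) = y"
  using assms by (simp_all flip: m_assoc)

lemma comm_subgroup_mono:
  assumes "A \<subseteq> A'" "B \<subseteq> B'"
  shows "comm_subgroup G A B \<subseteq> comm_subgroup G A' B'"
  unfolding comm_subgroup_def by (rule mono_generate) (use assms in blast)

lemma comm_subgroup_incl:
  assumes "subgroup H G" "A \<subseteq> H" "B \<subseteq> H"
  shows "comm_subgroup G A B \<subseteq> H"
  unfolding comm_subgroup_def
proof (rule generate_subgroup_incl[OF _ assms(1)])
  show "{commutator a b |a b. a \<in> A \<and> b \<in> B} \<subseteq> H"
    using assms by (auto intro!: subgroup.m_closed[OF assms(1)] subgroup.m_inv_closed[OF assms(1)])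
qed

lemma comm_subgroup_is_subgroup:
  assumes "A \<subseteq> carrier G" "B \<subseteq> carrier G"
  shows "subgroup (comm_subgroup G A B) G"
  unfolding comm_subgroup_def
  by (rule generate_is_subgroup) (use assms in \<open>auto intro!: m_closed\<close>)

lemma commutator_in_comm_subgroup:
  assumes "a \<in> A" "b \<in> B"
  shows "commutator a b \<in> comm_subgroup G A B"
  unfolding comm_subgroup_def by (rule generate.incl) (use assms in blast)

lemma lower_central_subgroup:
  assumes "subgroup H G"
  shows "subgroup (lower_central G H i) G \<and> lower_central G H i \<subseteq> H"
proof (induction i)
  case 0
  then show ?case using assms by simp
next
  case (Suc i)
  then show ?case
    using comm_subgroup_is_subgroup comm_subgroup_incl[OF assms] subgroup.subset[OF assms]
    by (metis lower_central.simps(2) order_refl subset_trans)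
qed

lemma lower_central_Suc_subset:
  assumes "subgroup H G"
  shows "lower_central G H (Suc i) \<subseteq> lower_central G H i"
proof (induction i)
  case 0
  then show ?case using lower_central_subgroup[OF assms, of 1] by simp
next
  case (Suc i)
  then show ?case using comm_subgroup_mono[OF Suc order_refl] by simp
qed

lemma lower_central_antimono:
  assumes "subgroup H G" "i \<le> j"
  shows "lower_central G H j \<subseteq> lower_central G H i"
  by (rule lift_Suc_antimono_le[of "lower_central G H"])
    (use lower_central_Suc_subset[OF assms(1)] assms(2) in auto)

lemma lower_central_mono:
  assumes "K \<subseteq> H"
  shows "lower_central G K i \<subseteq> lower_central G H i"
  by (induction i) (use assms in \<open>auto intro: comm_subgroup_mono[THEN subsetD]\<close>)

lemma nilpotent_class_le_iff_subset:
  assumes "subgroup H G"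
  shows "nilpotent_class_le G H n \<longleftrightarrow> lower_central G H n \<subseteq> {\<one>}"
  unfolding nilpotent_class_le_def
  using lower_central_subgroup[OF assms, of n] subgroup.one_closed by blast

lemma nilpotent_class_le_subgroup:
  assumes "subgroup H G" "subgroup K G" "K \<subseteq> H" "nilpotent_class_le G H n"
  shows "nilpotent_class_le G K n"
  using assms lower_central_mono[of K H n] by (auto simp: nilpotent_class_le_iff_subset)

text \<open>\<open>h x h^-1 = [x, h]^-1 x\<close>, and \<open>[x, h]\<close> lies in the next term,
  which is contained in the current one.\<close>

lemma conj_in_lower_central:
  assumes H: "subgroup H G" and h: "h \<in> H" and x: "x \<in> lower_central G H i"
  shows "h \<otimes> x \<otimes> inv h \<in> lower_central G H i"
proof -
  have L: "subgroup (lower_central G H i) G" "lower_central G H i \<subseteq> H"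
    using lower_central_subgroup[OF H] by auto
  have c: "x \<in> carrier G" "h \<in> carrier G"
    using L x h subgroup.subset[OF H] by auto
  have "commutator x h \<in> lower_central G H (Suc i)"
    using commutator_in_comm_subgroup[OF x h] by simp
  then have "inv (commutator x h) \<otimes> x \<in> lower_central G H i"
    using lower_central_Suc_subset[OF H, of i] L x
    by (meson subgroup.m_closed subgroup.m_inv_closed subsetD)
  also have "inv (commutator x h) \<otimes> x = h \<otimes> x \<otimes> inv h"
    using c by (simp add: inv_mult_group m_assoc)
  finally show ?thesis .
qed

section \<open>Commutators of two terms of the lower central series\<close>

lemma Hall_Witt:
  assumes "x \<in> carrier G" "y \<in> carrier G" "z \<in> carrier G"
  shows "(inv y \<otimes> commutator (commutator y (inv x)) (inv z) \<otimes> y)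
    \<otimes> (inv z \<otimes> commutator (commutator z (inv y)) (inv x) \<otimes> z)
    \<otimes> (inv x \<otimes> commutator (commutator x (inv z)) (inv y) \<otimes> x) = \<one>"
  using assms by (simp add: inv_mult_group m_assoc)

text \<open>The three subgroups argument, by induction on \<open>j\<close>. Indices start at 0, so
  the classical \<open>[gamma_(i+1), gamma_(j+1)] <= gamma_(i+j+2)\<close> shows up as
  \<open>i + j + 1\<close>. The induction keeps \<open>i\<close> arbitrary because the hypothesis is
  also used at \<open>Suc i\<close>.\<close>

lemma commutator_in_lower_central:
  assumes H: "subgroup H G"
  shows "a \<in> lower_central G H i \<Longrightarrow> b \<in> lower_central G H j
    \<Longrightarrow> commutator a b \<in> lower_central G H (i + j + 1)"
proof (induction j arbitrary: i a b)
  case 0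
  then show ?case using commutator_in_comm_subgroup[of a _ b H] by simp
next
  case (Suc j)
  note lc = lower_central_subgroup[OF H, THEN conjunct1]
  have lcH: "x \<in> H" if "x \<in> lower_central G H k" for x k
    using that lower_central_subgroup[OF H] by blast
  have Hc: "x \<in> carrier G" if "x \<in> H" for x
    using that subgroup.subset[OF H] by blast
  note lcc = lcH[THEN Hc]
  define N where "N = lower_central G H (i + j + 2)"
  have N: "subgroup N G" unfolding N_def by (rule lc)
  have conjN: "h \<otimes> x \<otimes> inv h \<in> N" if "h \<in> H" "x \<in> N" for h x
    using conj_in_lower_central[OF H] that unfolding N_def by blast
  have conjN': "inv h \<otimes> x \<otimes> h \<in> N" if "h \<in> H" "x \<in> N" for h x
    using conjN[OF subgroup.m_inv_closed[OF H that(1)] that(2)] Hc[OF that(1)] by simp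
  \<comment> \<open>The elements of \<open>H\<close> commuting with the \<open>i\<close>-th term
    modulo \<open>N\<close>. They form a subgroup because
    \<open>[a, y^-1] = y^-1 [a, y]^-1 y\<close> and
    \<open>[a, y z] = [a, y] (y [a, z] y^-1)\<close>, where \<open>H\<close> normalizes
    \<open>N\<close>. Hence only the generators \<open>[u, v]\<close> of the term
    \<open>Suc j\<close> have to be tested.\<close>
  define C where "C = {y \<in> H. \<forall>a \<in> lower_central G H i. commutator a y \<in> N}"
  have C: "subgroup C G"
  proof (rule subgroupI)
    show "C \<subseteq> carrier G" using Hc by (auto simp: C_def)
    have "\<one> \<in> C" using subgroup.one_closed[OF H] subgroup.one_closed[OF N] lcc by (auto simp: C_def)
    then show "C \<noteq> {}" by blast
  next
    fix y assume y: "y \<in> C"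
    have "commutator a (inv y) \<in> N" if a: "a \<in> lower_central G H i" for a
    proof -
      have "inv y \<otimes> inv (commutator a y) \<otimes> y \<in> N"
        using y a by (intro conjN' subgroup.m_inv_closed[OF N]) (simp_all add: C_def)
      also have "inv y \<otimes> inv (commutator a y) \<otimes> y = commutator a (inv y)"
        using y lcc[OF a] Hc by (simp add: C_def inv_mult_group m_assoc)
      finally show ?thesis .
    qed
    then show "inv y \<in> C" using y subgroup.m_inv_closed[OF H] by (auto simp: C_def)
  next
    fix y z assume yz: "y \<in> C" "z \<in> C"
    have "commutator a (y \<otimes> z) \<in> N" if a: "a \<in> lower_central G H i" for a
    proof -
      have "commutator a y \<otimes> (y \<otimes> commutator a z \<otimes> inv y) \<in> N"
        by (rule subgroup.m_closed[OF N _ conjN]) (use yz a in \<open>simp_all add: C_def\<close>)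
      also have "commutator a y \<otimes> (y \<otimes> commutator a z \<otimes> inv y) = commutator a (y \<otimes> z)"
        using yz lcc[OF a] Hc by (simp add: C_def inv_mult_group m_assoc)
      finally show ?thesis .
    qed
    then show "y \<otimes> z \<in> C" using yz subgroup.m_closed[OF H] by (auto simp: C_def)
  qed
  have "commutator u v \<in> C" if u: "u \<in> lower_central G H j" and v: "v \<in> H" for u v
  proof -
    have uH: "u \<in> H" by (rule lcH[OF u])
    have "commutator a (commutator u v) \<in> N" if a: "a \<in> lower_central G H i" for a
    proof -
      note car = lcc[OF a] lcc[OF u] Hc[OF v]
      have ia: "inv a \<in> lower_central G H i" and iu: "inv u \<in> lower_central G H j"
        and iv: "inv v \<in> H"
        using a u v lc H by (auto intro: subgroup.m_inv_closed)
      have "commutator (inv a) (inv u) \<in> lower_central G H (i + j + 1)"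
        by (rule Suc.IH[OF ia iu])
      from commutator_in_comm_subgroup[OF this v]
      have t2: "commutator (commutator (inv a) (inv u)) v \<in> N" by (simp add: N_def)
      \<comment> \<open>Here the extra commutator is taken first: \<open>[v^-1, a]\<close> lies in
        the term \<open>Suc i\<close>, so the induction hypothesis at \<open>Suc i\<close> and
        \<open>j\<close> again ends in \<open>N\<close>.\<close>
      have "inv (commutator a (inv v)) \<in> lower_central G H (Suc i)"
        using commutator_in_comm_subgroup[OF a iv] subgroup.m_inv_closed[OF lc[of "Suc i"]] by simp
      also have "inv (commutator a (inv v)) = commutator (inv v) a"
        using car by (simp add: inv_mult_group m_assoc)
      finally have "commutator (commutator (inv v) a) (inv u) \<in> lower_central G H (Suc i + j + 1)"
        by (rule Suc.IH[OF _ iu])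
      then have t3: "commutator (commutator (inv v) a) (inv u) \<in> N" by (simp add: N_def)
      \<comment> \<open>The second and third factors of the Hall-Witt identity for
        \<open>v^-1\<close>, \<open>u\<close>, \<open>a^-1\<close>. The first factor
        \<open>u^-1 [[u, v], a] u\<close> is therefore \<open>t^-1\<close>, and
        \<open>u t u^-1 = [[u, v], a]^-1 = [a, [u, v]]\<close>.\<close>
      define t where "t = (inv (inv a) \<otimes> commutator (commutator (inv a) (inv u)) v \<otimes> inv a)
          \<otimes> (v \<otimes> commutator (commutator (inv v) a) (inv u) \<otimes> inv v)"
      have t: "t \<in> N" unfolding t_def
        by (rule subgroup.m_closed[OF N conjN'[OF lcH[OF ia] t2] conjN[OF v t3]])
      have "u \<otimes> t \<otimes> inv u \<in> N" using conjN[OF uH t] .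
      also have "u \<otimes> t \<otimes> inv u = commutator a (commutator u v)"
      proof -
        have tc: "t \<in> carrier G" using t subgroup.subset[OF N] by blast
        have "(inv u \<otimes> commutator (commutator u v) a \<otimes> u) \<otimes> t = \<one>"
          using Hall_Witt[of "inv v" u "inv a"] car by (simp add: t_def m_assoc)
        then have "t = inv (inv u \<otimes> commutator (commutator u v) a \<otimes> u)"
          using car tc by (metis inv_closed inv_equality inv_inv m_closed)
        then show ?thesis using car by (simp add: inv_mult_group m_assoc)
      qed
      finally show ?thesis .
    qed
    then show ?thesis
      using uH v H by (auto simp: C_def intro!: subgroup.m_closed[OF H] subgroup.m_inv_closed[OF H])
  qed
  then have "lower_central G H (Suc j) \<subseteq> C"
    unfolding lower_central.simps comm_subgroup_def by (intro generate_subgroup_incl[OF _ C]) blast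
  with Suc.prems show ?case by (auto simp: C_def N_def)
qed

text \<open>Each derivation takes the term \<open>i\<close> into the term \<open>i + i + 1\<close>;
  starting from 0 this yields \<open>2 ^ k - 1\<close>, which is \<open>gamma_(2^k)\<close> in the
  classical numbering.\<close>

lemma exp_of_derived_subset_lower_central:
  assumes H: "subgroup H G"
  shows "(derived G ^^ k) H \<subseteq> lower_central G H (2 ^ k - 1)"
proof (induction k)
  case 0
  then show ?case by simp
next
  case (Suc k)
  define i :: nat where "i = 2 ^ k - 1"
  have i: "2 ^ Suc k - 1 = i + i + 1"
    by (cases "2 ^ k :: nat") (simp_all add: i_def)
  have "derived G (lower_central G H i) \<subseteq> lower_central G H (i + i + 1)"
    unfolding derived_def using commutator_in_lower_central[OF H]
    by (intro generate_subgroup_incl lower_central_subgroup[OF H, THEN conjunct1]) blast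
  with mono_derived[OF Suc] show ?case unfolding i by (auto simp: i_def)
qed

lemma exp_of_derived_trivial:
  assumes "subgroup H G" "(derived G ^^ k) H \<subseteq> {\<one>}" "k \<le> l"
  shows "(derived G ^^ l) H = {\<one>}"
proof -
  have one: "\<one> \<in> (derived G ^^ j) H" for j
    using subgroup.one_closed[OF exp_of_derived_is_subgroup[OF assms(1)]] .
  have "(derived G ^^ l) H \<subseteq> {\<one>}"
    using assms(3)
  proof (induction l rule: dec_induct)
    case base
    then show ?case by (rule assms(2))
  next
    case (step j)
    then show ?case using derived_incl[OF step.IH triv_subgroup] by simp
  qed
  then show ?thesis using one by blast
qed

lemma nilpotent_exp_of_derived:
  assumes "subgroup H G" "nilpotent_class_le G H n" "n < 2 ^ k"
  shows "(derived G ^^ k) H \<subseteq> {\<one>}"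
proof -
  have "n \<le> 2 ^ k - 1" using assms(3) by simp
  from lower_central_antimono[OF assms(1) this] show ?thesis
    using exp_of_derived_subset_lower_central[OF assms(1), of k] assms(2)
    by (simp add: nilpotent_class_le_def)
qed

text \<open>An element of a term is a word in iterated commutators and so involves only finitely
  many elements of \<open>H\<close>. For a product the two finite sets are united, the terms being
  monotone in the subgroup.\<close>

lemma lower_central_locally_generated:
  assumes H: "subgroup H G"
  shows "x \<in> lower_central G H i \<Longrightarrow>
    \<exists>A. finite A \<and> A \<subseteq> H \<and> x \<in> lower_central G (generate G A) i"
proof (induction i arbitrary: x)
  case 0
  then show ?case by (intro exI[of _ "{x}"]) (auto intro: generate.incl)
next
  case (Suc i)
  let ?L = "\<lambda>A. lower_central G (generate G A) (Suc i)"
  have mono: "?L A \<subseteq> ?L B" if "A \<subseteq> B" for A B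
    using lower_central_mono[OF mono_generate[OF that]] .
  have sub: "subgroup (?L A) G" if "A \<subseteq> H" for A
    using that subgroup.subset[OF H] lower_central_subgroup[OF generate_is_subgroup] by blast
  have gen: "\<exists>A. finite A \<and> A \<subseteq> H \<and> commutator a b \<in> ?L A"
    if a: "a \<in> lower_central G H i" and b: "b \<in> H" for a b
  proof -
    obtain A where A: "finite A" "A \<subseteq> H" "a \<in> lower_central G (generate G A) i"
      using Suc.IH[OF a] by blast
    have "a \<in> lower_central G (generate G (insert b A)) i"
      using A lower_central_mono[OF mono_generate, of A "insert b A"] by blast
    moreover have "b \<in> generate G (insert b A)" by (auto intro: generate.incl)
    ultimately show ?thesis
      using A b by (intro exI[of _ "insert b A"]) (auto intro: commutator_in_comm_subgroup)
  qed
  have "x \<in> generate G {commutator a b |a b. a \<in> lower_central G H i \<and> b \<in> H}"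
    using Suc.prems by (simp add: comm_subgroup_def)
  then show ?case
  proof (induction rule: generate.induct)
    case one
    have "\<one> \<in> ?L {}" using sub[of "{}"] subgroup.one_closed by blast
    then show ?case by blast
  next
    case (incl h)
    then show ?case using gen by blast
  next
    case (inv h)
    then obtain A where "finite A" "A \<subseteq> H" "h \<in> ?L A" using gen by blast
    then show ?case using subgroup.m_inv_closed[OF sub[of A]] by blast
  next
    case (eng h1 h2)
    then obtain A B where "finite A" "A \<subseteq> H" "h1 \<in> ?L A" "finite B" "B \<subseteq> H" "h2 \<in> ?L B" by blast
    moreover from this have "h1 \<in> ?L (A \<union> B)" "h2 \<in> ?L (A \<union> B)"
      using mono[of A "A \<union> B"] mono[of B "A \<union> B"] by blast+
    ultimately show ?case
      using subgroup.m_closed[OF sub[of "A \<union> B"]]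
      by (intro exI[of _ "A \<union> B"] conjI) simp_all
  qed
qed

lemma nilpotent_class_le_local:
  assumes H: "subgroup H G"
    and "\<And>A. finite A \<Longrightarrow> A \<subseteq> H \<Longrightarrow> nilpotent_class_le G (generate G A) n"
  shows "nilpotent_class_le G H n"
  unfolding nilpotent_class_le_iff_subset[OF H]
  using lower_central_locally_generated[OF H, of _ n] assms(2) unfolding nilpotent_class_le_def
  by fastforce

text \<open>Both directions are demanded so that \<open>I\<close> equals its conjugate even when
  \<open>I\<close> is infinite. The elementwise form is easy to carry along homomorphisms and to
  subgroups taken as groups.\<close>

definition normalizes :: "'a \<Rightarrow> 'a set \<Rightarrow> bool" where
  "normalizes x I \<longleftrightarrow> (\<forall>h \<in> I. x \<otimes> h \<otimes> inv x \<in> I \<and> inv x \<otimes> h \<otimes> x \<in> I)"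

text \<open>Take a term not contained in \<open>I\<close> whose successor is contained in
  \<open>I\<close>. Its commutators with \<open>I\<close> fall into \<open>I\<close>, so the whole
  term normalizes \<open>I\<close>.\<close>

lemma nilpotent_normalizer_condition:
  assumes M: "subgroup M G" and nil: "nilpotent_class_le G M n" and I: "subgroup I G" and IM: "I \<subset> M"
  shows "\<exists>x \<in> M - I. normalizes x I"
proof -
  have "lower_central G M n \<subseteq> I"
    using nil subgroup.one_closed[OF I] by (simp add: nilpotent_class_le_def)
  moreover have "\<not> lower_central G M 0 \<subseteq> I" using IM by auto
  ultimately obtain i where i: "\<not> lower_central G M i \<subseteq> I" "lower_central G M (Suc i) \<subseteq> I"
    using ex_least_nat_less[of "\<lambda>i. lower_central G M i \<subseteq> I" n] by blast
  then obtain x where x: "x \<in> lower_central G M i" "x \<notin> I" by blast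
  note lc = lower_central_subgroup[OF M, of i]
  have xM: "x \<in> M" using x lc by blast
  have *: "y \<otimes> h \<otimes> inv y \<in> I" if y: "y \<in> lower_central G M i" and h: "h \<in> I" for y h
  proof -
    have c: "y \<in> carrier G" "h \<in> carrier G"
      using y h lc subgroup.subset[OF M] subgroup.subset[OF I] by auto
    have "commutator y h \<in> I"
      using commutator_in_comm_subgroup[OF y, of h M] h IM i by auto
    then have "commutator y h \<otimes> h \<in> I" using h subgroup.m_closed[OF I] by blast
    then show ?thesis using c by (simp add: m_assoc)
  qed
  have "inv x \<in> lower_central G M i" using subgroup.m_inv_closed[OF conjunct1[OF lc] x(1)] .
  moreover have "inv (inv x) = x" using xM subgroup.subset[OF M] by auto
  ultimately have "normalizes x I"
    unfolding normalizes_def using *[OF x(1)] *[of "inv x"] by auto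
  then show ?thesis using xM x by blast
qed

end

section \<open>Finite simple groups whose proper subgroups satisfy the normalizer condition\<close>

text \<open>Both images are in bijection with the common partition of \<open>A\<close> into fibres.
  Used to count conjugates of a subgroup by its cosets, and cosets of a kernel by
  permutations.\<close>

lemma ex_bij_betw_images_same_fibres:
  assumes fibres: "\<And>x y. x \<in> A \<Longrightarrow> y \<in> A \<Longrightarrow> f x = f y \<longleftrightarrow> g x = g y"
  shows "\<exists>h. bij_betw h (f ` A) (g ` A)"
proof -
  have "inj_on (\<lambda>b. g (inv_into A f b)) (f ` A)"
  proof (rule inj_onI)
    fix b c assume bc: "b \<in> f ` A" "c \<in> f ` A" "g (inv_into A f b) = g (inv_into A f c)"
    then have "f (inv_into A f b) = f (inv_into A f c)"
      using fibres inv_into_into by metis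
    then show "b = c" using bc by (metis f_inv_into_f)
  qed
  moreover have "(\<lambda>b. g (inv_into A f b)) ` f ` A = g ` A"
    unfolding image_image
  proof (rule image_cong[OF refl])
    fix x assume "x \<in> A"
    then show "g (inv_into A f (f x)) = g x"
      using fibres[of "inv_into A f (f x)" x] by (simp add: f_inv_into_f inv_into_into)
  qed
  ultimately show ?thesis unfolding bij_betw_def by blast
qed

context group
begin

section \<open>Conjugates and normalizers of subgroups\<close>

definition conj_by :: "'a \<Rightarrow> 'a set \<Rightarrow> 'a set" where
  "conj_by g H = (\<lambda>h. g \<otimes> h \<otimes> inv g) ` H"

lemma conj_by_conj_by:
  assumes "g \<in> carrier G" "h \<in> carrier G" "H \<subseteq> carrier G"
  shows "conj_by g (conj_by h H) = conj_by (g \<otimes> h) H"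
  unfolding conj_by_def image_image
  by (rule image_cong) (use assms in \<open>auto simp: inv_mult_group m_assoc subset_iff\<close>)

lemma conj_by_one: "H \<subseteq> carrier G \<Longrightarrow> conj_by \<one> H = H"
  unfolding conj_by_def by (force simp: subset_iff image_iff)

lemma conj_by_carrier: "g \<in> carrier G \<Longrightarrow> H \<subseteq> carrier G \<Longrightarrow> conj_by g H \<subseteq> carrier G"
  unfolding conj_by_def by auto

lemma conj_by_inv:
  assumes "g \<in> carrier G" "H \<subseteq> carrier G"
  shows "conj_by (inv g) (conj_by g H) = H" "conj_by g (conj_by (inv g) H) = H"
  using assms by (simp_all add: conj_by_conj_by conj_by_one)

lemma conj_by_mono: "H \<subseteq> K \<Longrightarrow> conj_by g H \<subseteq> conj_by g K"
  unfolding conj_by_def by auto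

lemma conj_by_subgroup:
  assumes g: "g \<in> carrier G" and H: "subgroup H G"
  shows "subgroup (conj_by g H) G"
proof (rule subgroupI)
  have c: "h \<in> carrier G" if "h \<in> H" for h using that subgroup.subset[OF H] by blast
  show "conj_by g H \<subseteq> carrier G" using conj_by_carrier[OF g] subgroup.subset[OF H] .
  show "conj_by g H \<noteq> {}" using subgroup.one_closed[OF H] by (auto simp: conj_by_def)
  fix a assume "a \<in> conj_by g H"
  then obtain h where h: "h \<in> H" "a = g \<otimes> h \<otimes> inv g" by (auto simp: conj_by_def)
  have "inv a = g \<otimes> inv h \<otimes> inv g" using h c g by (simp add: inv_mult_group m_assoc)
  then show "inv a \<in> conj_by g H" using subgroup.m_inv_closed[OF H h(1)] by (auto simp: conj_by_def)
  fix b assume "b \<in> conj_by g H"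
  then obtain k where k: "k \<in> H" "b = g \<otimes> k \<otimes> inv g" by (auto simp: conj_by_def)
  have "a \<otimes> b = g \<otimes> (h \<otimes> k) \<otimes> inv g" using h k c g by (simp add: m_assoc)
  then show "a \<otimes> b \<in> conj_by g H" using subgroup.m_closed[OF H h(1) k(1)] by (auto simp: conj_by_def)
qed

lemma inj_on_conj_by:
  assumes "g \<in> carrier G"
  shows "inj_on (\<lambda>h. g \<otimes> h \<otimes> inv g) (carrier G)"
  using assms by (intro inj_onI) simp

lemma card_conj_by:
  assumes "g \<in> carrier G" "H \<subseteq> carrier G"
  shows "card (conj_by g H) = card H"
  unfolding conj_by_def using card_image[OF inj_on_subset[OF inj_on_conj_by]] assms by blast

lemma normalizes_iff_conj_by:
  assumes x: "x \<in> carrier G" and I: "I \<subseteq> carrier G"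
  shows "normalizes x I \<longleftrightarrow> conj_by x I = I"
proof -
  have "normalizes x I \<longleftrightarrow> conj_by x I \<subseteq> I \<and> conj_by (inv x) I \<subseteq> I"
    using x by (auto simp: normalizes_def conj_by_def)
  also have "conj_by (inv x) I \<subseteq> I \<longleftrightarrow> I \<subseteq> conj_by x I"
    using conj_by_mono[of "conj_by (inv x) I" I x] conj_by_mono[of I "conj_by x I" "inv x"]
      conj_by_inv[OF x I] by auto
  finally show ?thesis by auto
qed

definition normalizer_of :: "'a set \<Rightarrow> 'a set" where
  "normalizer_of I = {x \<in> carrier G. conj_by x I = I}"

lemma normalizer_of_subgroup:
  assumes "I \<subseteq> carrier G"
  shows "subgroup (normalizer_of I) G"
proof (rule subgroupI)
  show "normalizer_of I \<subseteq> carrier G" "normalizer_of I \<noteq> {}"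
    using conj_by_one[OF assms] by (auto simp: normalizer_of_def)
next
  fix a assume "a \<in> normalizer_of I"
  then show "inv a \<in> normalizer_of I"
    using conj_by_inv(1)[of a I] assms by (auto simp: normalizer_of_def)
next
  fix a b assume "a \<in> normalizer_of I" "b \<in> normalizer_of I"
  then show "a \<otimes> b \<in> normalizer_of I"
    using conj_by_conj_by[of a b I] assms by (auto simp: normalizer_of_def)
qed

lemma subgroup_subset_normalizer_of:
  assumes I: "subgroup I G"
  shows "I \<subseteq> normalizer_of I"
proof
  fix x assume x: "x \<in> I"
  have "normalizes x I" unfolding normalizes_def
    using x by (auto intro!: subgroup.m_closed[OF I] subgroup.m_inv_closed[OF I])
  then show "x \<in> normalizer_of I"
    using x subgroup.subset[OF I] normalizes_iff_conj_by by (auto simp: normalizer_of_def)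
qed

lemma normal_if_normalizer_of_eq_carrier:
  assumes I: "subgroup I G" and "normalizer_of I = carrier G"
  shows "I \<lhd> G"
  unfolding normal_inv_iff
proof (intro conjI ballI I)
  fix x h assume "x \<in> carrier G" "h \<in> I"
  moreover from this have "conj_by x I = I" using assms(2) by (auto simp: normalizer_of_def)
  ultimately show "x \<otimes> h \<otimes> inv x \<in> I" by (auto simp: conj_by_def)
qed

section \<open>Maximal subgroups\<close>

definition maximal_subgroup :: "'a set \<Rightarrow> bool" where
  "maximal_subgroup M \<longleftrightarrow> subgroup M G \<and> M \<noteq> carrier G
     \<and> (\<forall>P. subgroup P G \<longrightarrow> M \<subseteq> P \<longrightarrow> P \<noteq> carrier G \<longrightarrow> P = M)"

lemma maximal_subgroup_conj_by:
  assumes g: "g \<in> carrier G" and M: "maximal_subgroup M"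
  shows "maximal_subgroup (conj_by g M)"
proof -
  have sM: "subgroup M G" "M \<subseteq> carrier G"
    using M subgroup.subset by (auto simp: maximal_subgroup_def)
  have full: "P = carrier G" if "P \<subseteq> carrier G" "conj_by x P = carrier G" "x \<in> carrier G" for x P
  proof
    have "conj_by (inv x) (carrier G) = P" using conj_by_inv(1)[of x P] that by simp
    moreover have "y \<in> conj_by (inv x) (carrier G)" if "y \<in> carrier G" for y
      unfolding conj_by_def using \<open>x \<in> carrier G\<close> that
      by (intro image_eqI[of _ _ "x \<otimes> y \<otimes> inv x"]) (simp_all add: m_assoc)
    ultimately show "carrier G \<subseteq> P" by blast
  qed (use that in blast)
  show ?thesis
    unfolding maximal_subgroup_def
  proof (intro conjI allI impI)
    show "subgroup (conj_by g M) G" by (rule conj_by_subgroup[OF g sM(1)])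
    show "conj_by g M \<noteq> carrier G" using full[of M g] sM g M by (auto simp: maximal_subgroup_def)
    fix P assume P: "subgroup P G" "conj_by g M \<subseteq> P" "P \<noteq> carrier G"
    note Pc = subgroup.subset[OF P(1)]
    have "M \<subseteq> conj_by (inv g) P"
      using conj_by_mono[OF P(2), of "inv g"] conj_by_inv[OF g sM(2)] by simp
    moreover have "conj_by (inv g) P \<noteq> carrier G" using full[OF Pc, of "inv g"] g P by auto
    ultimately have "conj_by (inv g) P = M"
      using M conj_by_subgroup[of "inv g" P] g P by (auto simp: maximal_subgroup_def)
    then show "P = conj_by g M" using conj_by_inv(2)[OF g Pc] by simp
  qed
qed

lemma ex_maximal_subgroup:
  assumes fin: "finite (carrier G)" and P: "subgroup P G" "P \<noteq> carrier G"
  shows "\<exists>M. maximal_subgroup M \<and> P \<subseteq> M"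
proof -
  let ?S = "{P. subgroup P G \<and> P \<noteq> carrier G}"
  have "finite ?S"
    by (rule finite_subset[of _ "Pow (carrier G)"]) (use fin subgroup.subset in auto)
  from finite_has_maximal2[OF this, of P] P obtain M
    where "M \<in> ?S" "P \<subseteq> M" "\<forall>Q \<in> ?S. M \<subseteq> Q \<longrightarrow> M = Q" by auto
  then show ?thesis unfolding maximal_subgroup_def by blast
qed

text \<open>Schmidt's argument: distinct maximal subgroups meet trivially, since a largest nontrivial
  intersection would be enlarged by its normalizer. Each maximal subgroup is self-normalizing, so
  the conjugates of one maximal subgroup cover at least half of the group but leave out some
  nontrivial element, and the conjugates of a second one do not fit into the rest.\<close>

lemma simple_normalizer_condition_imp_comm:
  assumes fin: "finite (carrier G)"
    and simple: "\<And>N. N \<lhd> G \<Longrightarrow> N = carrier G \<or> N = {\<one>}"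
    and nc: "\<And>P I. subgroup P G \<Longrightarrow> P \<noteq> carrier G \<Longrightarrow> subgroup I G \<Longrightarrow> I \<subset> P
      \<Longrightarrow> \<exists>x \<in> P - I. normalizes x I"
  shows "\<forall>x \<in> carrier G. \<forall>y \<in> carrier G. x \<otimes> y = y \<otimes> x"
proof (rule ccontr)
  assume nonab: "\<not> ?thesis"
  have max: "subgroup M G" "M \<subseteq> carrier G" "M \<noteq> carrier G" "finite M"
    if "maximal_subgroup M" for M
    using that subgroup.subset fin finite_subset unfolding maximal_subgroup_def by metis+
  \<comment> \<open>A nonabelian group is not cyclic, so \<open>generate G {x}\<close> is proper and
    extends to a maximal subgroup.\<close>
  have cover: "\<exists>M. maximal_subgroup M \<and> x \<in> M" if x: "x \<in> carrier G" for x
  proof -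
    have "generate G {x} \<noteq> carrier G"
    proof
      assume eq: "generate G {x} = carrier G"
      have "u \<otimes> v = v \<otimes> u" if uv: "u \<in> carrier G" "v \<in> carrier G" for u v
      proof -
        have "u \<in> generate G {x}" "v \<in> generate G {x}" using uv eq by auto
        then obtain i j :: int where "u = x [^] i" "v = x [^] j"
          unfolding generate_pow[OF x] by blast
        then show ?thesis using x by (simp add: int_pow_mult[symmetric] add.commute)
      qed
      with nonab show False by blast
    qed
    with ex_maximal_subgroup[OF fin generate_is_subgroup[of "{x}"]] x
    obtain M where "maximal_subgroup M" "generate G {x} \<subseteq> M" by blast
    then show ?thesis using generate.incl[of x "{x}" G] by blast
  qed
  \<comment> \<open>If the trivial subgroup were maximal, every maximal subgroup would equal it,
    contradicting that a nontrivial \<open>x\<close> lies in one.\<close>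
  have nontriv: "M \<noteq> {\<one>}" if M: "maximal_subgroup M" for M
  proof
    assume M1: "M = {\<one>}"
    obtain x where x: "x \<in> carrier G" "x \<noteq> \<one>" using max(2,3)[OF M] M1 by blast
    obtain M' where M': "maximal_subgroup M'" "x \<in> M'" using cover[OF x(1)] by blast
    have "M' = M"
      using M M1 max(1,3)[OF M'(1)] subgroup.one_closed[OF max(1)[OF M'(1)]]
      unfolding maximal_subgroup_def by blast
    then show False using M' M1 x by blast
  qed
  have notnormal: "normalizer_of I \<noteq> carrier G"
    if "subgroup I G" "I \<noteq> {\<one>}" "I \<noteq> carrier G" for I
    using normal_if_normalizer_of_eq_carrier[OF that(1)] simple that by blast
  have inter: "A \<inter> B = {\<one>}" if "maximal_subgroup A" "maximal_subgroup B" "A \<noteq> B" for A B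
  proof (rule ccontr)
    assume "A \<inter> B \<noteq> {\<one>}"
    define Q where "Q = (\<lambda>(A, B). maximal_subgroup A \<and> maximal_subgroup B \<and> A \<noteq> B \<and> A \<inter> B \<noteq> {\<one>})"
    have "Q (A, B)" using that \<open>A \<inter> B \<noteq> {\<one>}\<close> by (simp add: Q_def)
    moreover have bound: "card (A \<inter> B) < Suc (card (carrier G))" if "Q (A, B)" for A B
      using that max(2) by (auto simp: Q_def less_Suc_eq_le intro!: card_mono[OF fin])
    ultimately obtain A B where AB: "Q (A, B)"
      and mx: "\<And>A' B'. Q (A', B') \<Longrightarrow> card (A' \<inter> B') \<le> card (A \<inter> B)"
      using ex_has_greatest_nat[of Q "(A, B)" "\<lambda>(A, B). card (A \<inter> B)" "Suc (card (carrier G))"]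
      by fastforce
    have A: "maximal_subgroup A" and B: "maximal_subgroup B" and ne: "A \<noteq> B" "A \<inter> B \<noteq> {\<one>}"
      using AB by (auto simp: Q_def)
    define I where "I = A \<inter> B"
    have I: "subgroup I G" unfolding I_def using max(1)[OF A] max(1)[OF B] subgroups_Inter_pair by blast
    have Ic: "I \<noteq> carrier G" using max(2,3)[OF A] by (auto simp: I_def)
    \<comment> \<open>By simplicity \<open>I\<close> is not normal, so its normalizer is
      proper.\<close>
    obtain M where M: "maximal_subgroup M" "normalizer_of I \<subseteq> M"
      using ex_maximal_subgroup[OF fin normalizer_of_subgroup[OF subgroup.subset[OF I]]]
        notnormal[OF I _ Ic] ne by (auto simp: I_def)
    \<comment> \<open>The normalizer condition inside \<open>C\<close> gives some \<open>x\<close>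
      outside \<open>I\<close> that lies in both \<open>C\<close> and \<open>M\<close>. So
      \<open>C\<close> and \<open>M\<close> meet in more than \<open>I\<close>, against the choice
      of \<open>I\<close>, unless they coincide. Applied to \<open>A\<close> and to
      \<open>B\<close>, this forces \<open>A = M = B\<close>.\<close>
    have eqM: "C = M" if C: "maximal_subgroup C" and IC: "I \<subset> C" for C
    proof (rule ccontr)
      assume "C \<noteq> M"
      obtain x where x: "x \<in> C - I" "normalizes x I"
        using nc[OF max(1)[OF C] max(3)[OF C] I IC] by blast
      have "x \<in> M" using x M max(2)[OF C] normalizes_iff_conj_by[of x I] subgroup.subset[OF I]
        by (auto simp: normalizer_of_def)
      then have less: "I \<subset> C \<inter> M"
        using x IC M(2) subgroup_subset_normalizer_of[OF I] by blast
      then have "card I < card (C \<inter> M)" using max(4)[OF C] by (auto intro: psubset_card_mono)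
      moreover have "C \<inter> M \<noteq> {\<one>}"
        using x \<open>x \<in> M\<close> subgroup.one_closed[OF I] by (metis DiffE IntI singletonD)
      ultimately show False using mx[of C M] C M(1) \<open>C \<noteq> M\<close> by (simp add: Q_def I_def)
    qed
    have "\<not> A \<subseteq> B" "\<not> B \<subseteq> A"
      using A B ne(1) max(1,3)[OF A] max(1,3)[OF B] unfolding maximal_subgroup_def by metis+
    then have "I \<subset> A" "I \<subset> B" by (auto simp: I_def)
    then show False using eqM A B ne(1) by metis
  qed
  define U where "U = (\<lambda>M. (\<Union>g \<in> carrier G. conj_by g M) - {\<one>})"
  \<comment> \<open>\<open>k\<close> is the index of \<open>M\<close>, which is the number of its
    conjugates. As these meet trivially, \<open>card (U M)\<close> is
    \<open>k * (card M - 1)\<close>, that is \<open>card (carrier G) - k\<close>;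
    \<open>card M \<ge> 2\<close> makes this at least half of the group, and
    \<open>k \<ge> 2\<close> leaves room for a nontrivial element outside.\<close>
  have count: "\<exists>k \<ge> 2. card (U M) + k = card (carrier G) \<and> card (carrier G) \<le> 2 * card (U M)"
    if M: "maximal_subgroup M" for M
  proof -
    note sM = max[OF M]
    \<comment> \<open>Conjugating by \<open>inv g\<close> rather than \<open>g\<close> makes the
      fibres right cosets: \<open>x\<close> and \<open>y\<close> give the same conjugate iff
      \<open>y x^-1\<close> normalizes \<open>M\<close>, and \<open>M\<close> is its own
      normalizer.\<close>
    define cl where "cl = (\<lambda>g. conj_by (inv g) M) ` carrier G"
    have cl: "maximal_subgroup C \<and> card C = card M" if "C \<in> cl" for C
      using that maximal_subgroup_conj_by[OF _ M] card_conj_by[OF _ sM(2)] by (auto simp: cl_def)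
    have self: "normalizer_of M = M"
      using M normalizer_of_subgroup[OF sM(2)] subgroup_subset_normalizer_of[OF sM(1)]
        notnormal[OF sM(1) nontriv[OF M] sM(3)] by (auto simp: maximal_subgroup_def)
    have fibres: "conj_by (inv x) M = conj_by (inv y) M \<longleftrightarrow> M #> x = M #> y"
      if xy: "x \<in> carrier G" "y \<in> carrier G" for x y
    proof -
      have "conj_by (inv x) M = conj_by (inv y) M \<longleftrightarrow> conj_by (y \<otimes> inv x) M = M"
        using xy sM(2) conj_by_conj_by[of y "inv x" M] conj_by_inv(2)[of y M]
          conj_by_inv(1)[of y "conj_by (inv x) M"] conj_by_carrier[of "inv x" M] by auto
      also have "\<dots> \<longleftrightarrow> y \<otimes> inv x \<in> M"
        using self xy unfolding normalizer_of_def by blast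
      also have "\<dots> \<longleftrightarrow> M #> x = M #> y"
        using subgroup.rcos_module[OF sM(1) is_group xy(1), of y] xy sM
        by (metis repr_independence repr_independenceD rcos_self)
      finally show ?thesis .
    qed
    obtain \<beta> where "bij_betw \<beta> cl ((\<lambda>x. M #> x) ` carrier G)"
      unfolding cl_def
      using ex_bij_betw_images_same_fibres[of "carrier G" "\<lambda>g. conj_by (inv g) M" "\<lambda>x. M #> x"] fibres
      by auto
    then have "card cl = card ((\<lambda>x. M #> x) ` carrier G)" by (rule bij_betw_same_card)
    also have "(\<lambda>x. M #> x) ` carrier G = rcosets M" by (auto simp: RCOSETS_def)
    finally have idx: "card cl * card M = card (carrier G)"
      using lagrange[OF sM(1)] by (simp add: order_def)
    have "U M = (\<Union>C \<in> cl. C - {\<one>})"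
    proof -
      have "(\<lambda>g. conj_by g M) ` carrier G = cl"
      proof -
        have "m_inv G ` carrier G = carrier G" by (auto simp: image_iff) (metis inv_closed inv_inv)
        then have "(\<lambda>g. conj_by g M) ` carrier G = (\<lambda>g. conj_by g M) ` m_inv G ` carrier G" by simp
        then show ?thesis unfolding cl_def image_image .
      qed
      then show ?thesis unfolding U_def by auto
    qed
    also have "card \<dots> = (\<Sum>C \<in> cl. card (C - {\<one>}))"
    proof (rule card_UN_disjoint)
      show "finite cl" using fin by (simp add: cl_def)
      show "\<forall>C \<in> cl. finite (C - {\<one>})" using cl max(4) by blast
      show "\<forall>C \<in> cl. \<forall>D \<in> cl. C \<noteq> D \<longrightarrow> (C - {\<one>}) \<inter> (D - {\<one>}) = {}"
        using cl inter by blast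
    qed
    also have "\<dots> = (\<Sum>C \<in> cl. card M - 1)"
    proof (rule sum.cong[OF refl])
      fix C assume "C \<in> cl"
      then show "card (C - {\<one>}) = card M - 1"
        using cl subgroup.one_closed[OF max(1)] by (simp add: card_Diff_singleton)
    qed
    finally have U: "card (U M) = card cl * (card M - 1)" by simp
    have "M - {\<one>} \<noteq> {}" using nontriv[OF M] subgroup.one_closed[OF sM(1)] by blast
    then have "card (M - {\<one>}) > 0" using sM(4) by (simp add: card_gt_0_iff)
    then have M2: "card M \<ge> 2"
      using subgroup.one_closed[OF sM(1)] by (simp add: card_Diff_singleton)
    have "card M < card (carrier G)" using sM fin by (intro psubset_card_mono) auto
    then have "card cl \<noteq> 0" "card cl \<noteq> 1" using idx by (metis mult_0 not_less_zero, metis mult_1 less_irrefl)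
    then have "card cl \<ge> 2" by linarith
    \<comment> \<open>Writing \<open>card M\<close> as \<open>2 + r\<close> removes the truncated
      subtraction in \<open>card M - 1\<close>.\<close>
    moreover obtain r where r: "card M = 2 + r" using M2 nat_le_iff_add by blast
    have "card (U M) + card cl = card (carrier G)" "card (carrier G) \<le> 2 * card (U M)"
      unfolding U idx[symmetric] r by (simp_all add: algebra_simps)
    ultimately show ?thesis by blast
  qed
  have Usub: "U M \<subseteq> carrier G - {\<one>}" if "maximal_subgroup M" for M
    using conj_by_carrier max(2)[OF that] by (auto simp: U_def)
  have card1: "card (carrier G - {\<one>}) + 1 = card (carrier G)"
    using card_Suc_Diff1[OF fin one_closed] by simp
  obtain M where M: "maximal_subgroup M" using cover[of \<one>] by auto
  obtain k where k: "k \<ge> 2" "card (U M) + k = card (carrier G)" using count[OF M] by blast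
  have "U M \<noteq> carrier G - {\<one>}"
  proof
    assume "U M = carrier G - {\<one>}"
    then have "card (U M) = card (carrier G - {\<one>})" by (rule arg_cong)
    then show False using k card1 by linarith
  qed
  then obtain x where x: "x \<in> carrier G" "x \<noteq> \<one>" "x \<notin> U M" using Usub[OF M] by blast
  obtain M' where M': "maximal_subgroup M'" "x \<in> M'" using cover[OF x(1)] by blast
  \<comment> \<open>A common nontrivial element would make a conjugate of \<open>M\<close> equal to
    a conjugate of \<open>M'\<close>; then \<open>M'\<close> is conjugate to \<open>M\<close> and
    \<open>x\<close> would lie in \<open>U M\<close>.\<close>
  have "U M \<inter> U M' = {}"
  proof (rule ccontr)
    assume "U M \<inter> U M' \<noteq> {}"
    then obtain z g h where z: "z \<noteq> \<one>" and g: "g \<in> carrier G" "z \<in> conj_by g M"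
      and h: "h \<in> carrier G" "z \<in> conj_by h M'" by (auto simp: U_def)
    have "conj_by g M = conj_by h M'"
      using inter[OF maximal_subgroup_conj_by[OF g(1) M] maximal_subgroup_conj_by[OF h(1) M'(1)]]
        z g h by blast
    then have "M' = conj_by (inv h \<otimes> g) M"
      using conj_by_inv(1)[OF h(1) max(2)[OF M'(1)]] conj_by_conj_by[of "inv h" g M] g h max(2)[OF M]
      by simp
    then show False using x M'(2) g h by (auto simp: U_def)
  qed
  moreover have "finite (U M)" "finite (U M')"
    using Usub[OF M] Usub[OF M'(1)] fin by (meson finite_Diff finite_subset)+
  ultimately have "card (U M) + card (U M') = card (U M \<union> U M')" by (simp add: card_Un_disjoint)
  also have "\<dots> \<le> card (carrier G - {\<one>})"
    using Usub[OF M] Usub[OF M'(1)] fin by (intro card_mono) auto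
  finally have "card (U M) + card (U M') < card (carrier G)" using card1 by linarith
  moreover have "card (carrier G) \<le> 2 * card (U M)" "card (carrier G) \<le> 2 * card (U M')"
    using count[OF M] count[OF M'(1)] by blast+
  ultimately show False by linarith
qed

end

section \<open>Minimal non-nilpotent groups\<close>

context group_hom
begin

lemma subgroup_preimage:
  assumes L: "subgroup L H"
  shows "subgroup {x \<in> carrier G. h x \<in> L} G"
proof (rule G.subgroupI)
  show "{x \<in> carrier G. h x \<in> L} \<noteq> {}"
    using subgroup.one_closed[OF L] hom_one by (metis (mono_tags, lifting) G.one_closed empty_iff mem_Collect_eq)
qed (use subgroup.m_closed[OF L] subgroup.m_inv_closed[OF L] in auto)

lemma normal_preimage:
  assumes L: "L \<lhd> H"
  shows "{x \<in> carrier G. h x \<in> L} \<lhd> G"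
  unfolding G.normal_inv_iff
  using subgroup_preimage[OF normal_imp_subgroup[OF L]] normal.inv_op_closed2[OF L] by auto

lemma hom_commutator:
  assumes "a \<in> carrier G" "b \<in> carrier G"
  shows "h (G.commutator a b) = H.commutator (h a) (h b)"
  using assms by simp

text \<open>Used in two cases: \<open>L\<close> trivial, to place the derived subgroup in the kernel
  of a map onto an abelian group, and \<open>L\<close> the derived subgroup of the target.\<close>

lemma derived_subset_preimage:
  assumes L: "subgroup L H" and "derived H (carrier H) \<subseteq> L"
  shows "derived G (carrier G) \<subseteq> {x \<in> carrier G. h x \<in> L}"
  unfolding derived_def
proof (rule G.generate_subgroup_incl[OF _ subgroup_preimage[OF L]])
  have "H.commutator (h a) (h b) \<in> L" if "a \<in> carrier G" "b \<in> carrier G" for a b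
  proof -
    have "H.commutator (h a) (h b) \<in> derived H (carrier H)"
      unfolding derived_def by (rule generate.incl) (use that hom_closed in blast)
    then show ?thesis using assms(2) by blast
  qed
  then show "derived_set G (carrier G) \<subseteq> {x \<in> carrier G. h x \<in> L}" by auto
qed

lemma lower_central_img:
  assumes K: "subgroup K G"
  shows "lower_central H (h ` K) i = h ` lower_central G K i"
proof (induction i)
  case 0
  then show ?case by simp
next
  case (Suc i)
  let ?L = "lower_central G K i"
  have c: "?L \<subseteq> carrier G" "K \<subseteq> carrier G"
    using G.lower_central_subgroup[OF K, of i] subgroup.subset[OF K] by auto
  have "{H.commutator a b |a b. a \<in> h ` ?L \<and> b \<in> h ` K}
      = h ` {G.commutator a b |a b. a \<in> ?L \<and> b \<in> K}"
  proof -
    have "H.commutator (h a) (h b) = h (G.commutator a b)" if "a \<in> ?L" "b \<in> K" for a b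
      using hom_commutator[of a b] that c by (metis subsetD)
    then show ?thesis by (auto simp: image_iff) metis+
  qed
  moreover have "{G.commutator a b |a b. a \<in> ?L \<and> b \<in> K} \<subseteq> carrier G"
    using c by (auto intro!: G.m_closed)
  ultimately show ?case
    unfolding lower_central.simps Suc comm_subgroup_def by (metis (no_types, lifting) generate_img)
qed

lemma nilpotent_class_le_img:
  assumes "subgroup K G" "nilpotent_class_le G K n"
  shows "nilpotent_class_le H (h ` K) n"
  using assms by (simp add: nilpotent_class_le_def lower_central_img)

end

text \<open>This concerns the proper subgroups \<open>P\<close> of \<open>G\<close>, each of which
  has to satisfy the usual normalizer condition; \<open>G\<close> itself may fail it. It keeps what
  Schmidt's argument takes from nilpotency of all proper subgroups.\<close>

definition normalizer_condition :: "('a, 'b) monoid_scheme \<Rightarrow> bool" where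
  "normalizer_condition G \<longleftrightarrow> (\<forall>P I. subgroup P G \<longrightarrow> P \<noteq> carrier G \<longrightarrow> subgroup I G \<longrightarrow> I \<subset> P
     \<longrightarrow> (\<exists>x \<in> P - I. group.normalizes G x I))"

text \<open>By surjectivity the full preimages of \<open>P\<close> and \<open>I\<close> are again
  proper and strictly nested; the image of a normalizing element upstairs works downstairs.\<close>

lemma (in group_hom) normalizer_condition_img:
  assumes surj: "h ` carrier G = carrier H" and nc: "normalizer_condition G"
  shows "normalizer_condition H"
  unfolding normalizer_condition_def
proof (intro allI impI)
  fix P I assume P: "subgroup P H" "P \<noteq> carrier H" and I: "subgroup I H" "I \<subset> P"
  let ?pre = "\<lambda>L. {x \<in> carrier G. h x \<in> L}"
  have img: "h ` ?pre L = L" if "subgroup L H" for L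
    using surj subgroup.subset[OF that] by auto
  have "?pre P \<noteq> carrier G" using img[OF P(1)] surj P(2) by auto
  moreover have "?pre I \<subset> ?pre P" using img[OF P(1)] img[OF I(1)] I(2) by blast
  ultimately obtain x where x: "x \<in> ?pre P - ?pre I" "G.normalizes x (?pre I)"
    using nc subgroup_preimage[OF P(1)] subgroup_preimage[OF I(1)]
    unfolding normalizer_condition_def by meson
  have "H.normalizes (h x) I"
    unfolding H.normalizes_def
  proof
    fix k assume "k \<in> I"
    then obtain y where y: "y \<in> ?pre I" "k = h y" using img[OF I(1)] by blast
    then show "h x \<otimes>\<^bsub>H\<^esub> k \<otimes>\<^bsub>H\<^esub> inv\<^bsub>H\<^esub> h x \<in> I \<and> inv\<^bsub>H\<^esub> h x \<otimes>\<^bsub>H\<^esub> k \<otimes>\<^bsub>H\<^esub> h x \<in> I"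
      using x unfolding G.normalizes_def by auto
  qed
  then show "\<exists>x \<in> P - I. H.normalizes x I" using x by blast
qed

context normal
begin

lemma group_hom_Mod: "group_hom G (G Mod H) (\<lambda>a. H #> a)"
  using r_coset_hom_Mod factorgroup_is_group is_group
  by (simp add: group_hom_def group_hom_axioms_def)

lemma img_Mod: "(\<lambda>a. H #> a) ` carrier G = carrier (G Mod H)"
  by (simp add: carrier_FactGroup)

lemma r_coset_eq_one_Mod_iff: "x \<in> carrier G \<Longrightarrow> H #> x = \<one>\<^bsub>G Mod H\<^esub> \<longleftrightarrow> x \<in> H"
  using coset_join1[OF _ _ subgroup_axioms] coset_join2[OF _ subgroup_axioms] by auto

end

context group
begin

text \<open>The quotient by a maximal proper normal subgroup \<open>R\<close> is simple and inherits
  the condition, so it is abelian and the derived subgroup lies in \<open>R\<close>.\<close>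

lemma derived_proper_if_normalizer_condition:
  assumes fin: "finite (carrier G)" and nontriv: "carrier G \<noteq> {\<one>}" and nc: "normalizer_condition G"
  shows "derived G (carrier G) \<noteq> carrier G"
proof -
  let ?S = "{N. N \<lhd> G \<and> N \<noteq> carrier G}"
  have "finite ?S"
    by (rule finite_subset[of _ "Pow (carrier G)"])
      (use fin subgroup.subset[OF normal_imp_subgroup] in blast)+
  moreover have "{\<one>} \<in> ?S" using one_is_normal nontriv by auto
  ultimately obtain R where R: "R \<lhd> G" "R \<noteq> carrier G"
    and Rmax: "\<And>N. N \<lhd> G \<Longrightarrow> N \<noteq> carrier G \<Longrightarrow> R \<subseteq> N \<Longrightarrow> N = R"
    using finite_has_maximal2[of ?S "{\<one>}"] by auto
  interpret R: normal R G by (rule R(1))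
  interpret pi: group_hom G "G Mod R" "\<lambda>a. R #> a" by (rule R.group_hom_Mod)
  have simple: "N = carrier (G Mod R) \<or> N = {\<one>\<^bsub>G Mod R\<^esub>}" if N: "N \<lhd> G Mod R" for N
  proof -
    let ?N = "{x \<in> carrier G. R #> x \<in> N}"
    note sN = normal_imp_subgroup[OF N]
    have img: "(\<lambda>a. R #> a) ` ?N = N"
      using subgroup.subset[OF sN] unfolding R.img_Mod[symmetric] by auto
    have one: "R #> x = \<one>\<^bsub>G Mod R\<^esub>" if "x \<in> R" for x
      using R.r_coset_eq_one_Mod_iff[of x] R.subset that by blast
    have "R \<subseteq> ?N" using one R.subset subgroup.one_closed[OF sN] by auto
    then have "?N = carrier G \<or> ?N = R" using Rmax[OF pi.normal_preimage[OF N]] by blast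
    then show ?thesis
    proof
      assume "?N = carrier G"
      then show ?thesis using img R.img_Mod by simp
    next
      assume "?N = R"
      then have "N = (\<lambda>a. R #> a) ` R" using img by simp
      then have "N \<subseteq> {\<one>\<^bsub>G Mod R\<^esub>}" using one by blast
      then show ?thesis using subgroup.one_closed[OF sN] by blast
    qed
  qed
  have "finite (carrier (G Mod R))" unfolding R.img_Mod[symmetric] using fin by simp
  moreover have "\<exists>x \<in> P - I. group.normalizes (G Mod R) x I"
    if "subgroup P (G Mod R)" "P \<noteq> carrier (G Mod R)" "subgroup I (G Mod R)" "I \<subset> P" for P I
    using pi.normalizer_condition_img[OF R.img_Mod nc] that unfolding normalizer_condition_def by blast
  ultimately have comm: "\<forall>x \<in> carrier (G Mod R). \<forall>y \<in> carrier (G Mod R).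
      x \<otimes>\<^bsub>G Mod R\<^esub> y = y \<otimes>\<^bsub>G Mod R\<^esub> x"
    using simple by (intro pi.H.simple_normalizer_condition_imp_comm)
  then have "comm_group (G Mod R)" by (intro pi.H.group_comm_groupI) blast
  then have "derived (G Mod R) (carrier (G Mod R)) = {\<one>\<^bsub>G Mod R\<^esub>}"
    by (rule comm_group.derived_eq_singleton) simp
  with pi.derived_subset_preimage[OF pi.H.triv_subgroup]
  have "derived G (carrier G) \<subseteq> R" using R.r_coset_eq_one_Mod_iff by auto
  then show ?thesis using R R.subset by blast
qed

text \<open>Some finitely generated subgroup of \<open>H\<close> already violates the class bound
  and by minimality is \<open>H\<close> itself. Local gradedness then gives a nontrivial finite
  quotient, whose derived subgroup is proper; its preimage is \<open>M\<close>.\<close>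

lemma minimal_non_nilpotent_derived:
  assumes lg: "locally_graded G" and H: "subgroup H G" and non: "\<not> nilpotent_class_le G H n"
    and min: "\<And>P. subgroup P G \<Longrightarrow> P \<subset> H \<Longrightarrow> nilpotent_class_le G P n"
  shows "\<exists>M. subgroup M G \<and> nilpotent_class_le G M n \<and> derived G H \<subseteq> M"
proof -
  obtain A where A: "finite A" "A \<subseteq> H" "\<not> nilpotent_class_le G (generate G A) n"
    using nilpotent_class_le_local[OF H] non by blast
  have Ac: "A \<subseteq> carrier G" using A(2) subgroup.subset[OF H] by blast
  have gen: "generate G A = H"
    using A min[OF generate_is_subgroup[OF Ac]] generate_subgroup_incl[OF A(2) H] by blast
  have "H \<noteq> {\<one>}"
    using non lower_central_subgroup[OF H, of n] nilpotent_class_le_iff_subset[OF H] by auto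
  then have "has_nontrivial_finite_image G H"
    using lg A(1) Ac gen unfolding locally_graded_def by blast
  then obtain N where N: "N \<lhd> G\<lparr>carrier := H\<rparr>" "N \<noteq> H"
    and fin: "finite (rcosets\<^bsub>G\<lparr>carrier := H\<rparr>\<^esub> N)"
    unfolding has_nontrivial_finite_image_def by blast
  interpret H: group "G\<lparr>carrier := H\<rparr>" by (rule subgroup_imp_group[OF H])
  interpret N: normal N "G\<lparr>carrier := H\<rparr>" by (rule N(1))
  let ?Q = "G\<lparr>carrier := H\<rparr> Mod N"
  let ?pi = "\<lambda>a. N #>\<^bsub>G\<lparr>carrier := H\<rparr>\<^esub> a"
  interpret pi: group_hom "G\<lparr>carrier := H\<rparr>" ?Q ?pi by (rule N.group_hom_Mod)
  have sub: "subgroup P G" if "subgroup P (G\<lparr>carrier := H\<rparr>)" for P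
    using incl_subgroup[OF H that] .
  have "normalizer_condition (G\<lparr>carrier := H\<rparr>)"
    unfolding normalizer_condition_def
  proof (intro allI impI)
    fix P I
    assume P: "subgroup P (G\<lparr>carrier := H\<rparr>)" "P \<noteq> carrier (G\<lparr>carrier := H\<rparr>)"
      and I: "subgroup I (G\<lparr>carrier := H\<rparr>)" "I \<subset> P"
    have PH: "P \<subset> H" using P subgroup.subset[OF P(1)] by auto
    obtain x where x: "x \<in> P - I" "normalizes x I"
      using nilpotent_normalizer_condition[OF sub[OF P(1)] min[OF sub[OF P(1)] PH] sub[OF I(1)] I(2)]
      by blast
    have "inv\<^bsub>G\<lparr>carrier := H\<rparr>\<^esub> x = inv x" using m_inv_consistent[OF H, of x] x PH by blast
    then have "H.normalizes x I" using x(2) unfolding H.normalizes_def normalizes_def by simp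
    then show "\<exists>x \<in> P - I. H.normalizes x I" using x by blast
  qed
  then have "normalizer_condition ?Q" by (rule pi.normalizer_condition_img[OF N.img_Mod])
  moreover have "finite (carrier ?Q)" using fin by (simp add: FactGroup_def)
  moreover have "carrier ?Q \<noteq> {\<one>\<^bsub>?Q\<^esub>}"
  proof
    assume triv: "carrier ?Q = {\<one>\<^bsub>?Q\<^esub>}"
    have "x \<in> N" if "x \<in> H" for x
    proof -
      have "?pi x \<in> carrier ?Q" using that pi.hom_closed by simp
      then have "?pi x = \<one>\<^bsub>?Q\<^esub>" using triv by blast
      then show ?thesis using N.r_coset_eq_one_Mod_iff[of x] that by simp
    qed
    then show False using N(2) N.subset by auto
  qed
  ultimately have D: "derived ?Q (carrier ?Q) \<noteq> carrier ?Q"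
    by (intro pi.H.derived_proper_if_normalizer_condition)
  have sD: "subgroup (derived ?Q (carrier ?Q)) ?Q" by (rule pi.H.derived_is_subgroup) simp
  \<comment> \<open>\<open>M\<close> is \<open>H' N\<close>. It is proper since the quotient is not
    perfect, so minimality of \<open>H\<close> bounds its class.\<close>
  define M where "M = {x \<in> carrier (G\<lparr>carrier := H\<rparr>). ?pi x \<in> derived ?Q (carrier ?Q)}"
  have M: "subgroup M G" unfolding M_def by (rule sub[OF pi.subgroup_preimage[OF sD]])
  have "M \<noteq> H"
  proof
    assume "M = H"
    then have "?pi ` H \<subseteq> derived ?Q (carrier ?Q)" unfolding M_def by auto
    then show False using D N.img_Mod subgroup.subset[OF sD] by auto
  qed
  then have "nilpotent_class_le G M n" using min[OF M] by (auto simp: M_def)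
  moreover have "derived G H \<subseteq> M"
    using pi.derived_subset_preimage[OF sD order_refl] derived_consistent[OF order_refl H]
    by (simp add: M_def)
  ultimately show ?thesis using M by blast
qed

section \<open>The kernel of conjugation on a finite set of subgroups\<close>

lemma group_hom_conj:
  assumes "g \<in> carrier G"
  shows "group_hom G G (\<lambda>x. g \<otimes> x \<otimes> inv g)"
proof -
  have "(\<lambda>x. g \<otimes> x \<otimes> inv g) \<in> hom G G"
    using assms by (intro homI) (simp_all add: m_assoc)
  then show ?thesis by (simp add: group_hom_def group_hom_axioms_def is_group)
qed

lemma nilpotent_class_le_conj_by_iff:
  assumes g: "g \<in> carrier G" and H: "subgroup H G"
  shows "nilpotent_class_le G (conj_by g H) n \<longleftrightarrow> nilpotent_class_le G H n"
proof -
  have "nilpotent_class_le G (conj_by x K) n"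
    if "x \<in> carrier G" "subgroup K G" "nilpotent_class_le G K n" for x K
    using group_hom.nilpotent_class_le_img[OF group_hom_conj] that unfolding conj_by_def by blast
  from this[OF g H] this[OF inv_closed[OF g] conj_by_subgroup[OF g H]] show ?thesis
    using conj_by_inv(1)[OF g subgroup.subset[OF H]] by auto
qed

text \<open>Conjugations act on each cyclic subgroup by power maps, and these commute. So every
  commutator is central and the derived subgroup is abelian; the classification of Dedekind groups
  is avoided.\<close>

lemma derived_derived_trivial_if_cyclic_normal:
  assumes cyc: "\<And>g x. g \<in> carrier G \<Longrightarrow> x \<in> carrier G \<Longrightarrow> g \<otimes> x \<otimes> inv g \<in> generate G {x}"
  shows "derived G (derived G (carrier G)) = {\<one>}"
proof -
  have pow: "\<exists>k::int. g \<otimes> x \<otimes> inv g = x [^] k" if "g \<in> carrier G" "x \<in> carrier G" for g x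
    using cyc[OF that] generate_pow[OF that(2)] by auto
  have swap: "(a \<otimes> b) \<otimes> x \<otimes> inv (a \<otimes> b) = (b \<otimes> a) \<otimes> x \<otimes> inv (b \<otimes> a)"
    if c: "a \<in> carrier G" "b \<in> carrier G" "x \<in> carrier G" for a b x
  proof -
    obtain i j :: int where i: "a \<otimes> x \<otimes> inv a = x [^] i" and j: "b \<otimes> x \<otimes> inv b = x [^] j"
      using pow[OF c(1,3)] pow[OF c(2,3)] by blast
    have "(a \<otimes> b) \<otimes> x \<otimes> inv (a \<otimes> b) = a \<otimes> (b \<otimes> x \<otimes> inv b) \<otimes> inv a"
      using c by (simp add: inv_mult_group m_assoc)
    also have "\<dots> = x [^] (i * j)"
      unfolding j using group_hom.hom_int_pow[OF group_hom_conj[OF c(1)] c(3), of j] i c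
      by (simp add: int_pow_pow)
    also have "\<dots> = b \<otimes> (a \<otimes> x \<otimes> inv a) \<otimes> inv b"
      unfolding i using group_hom.hom_int_pow[OF group_hom_conj[OF c(2)] c(3), of i] j c
      by (simp add: int_pow_pow mult.commute)
    also have "\<dots> = (b \<otimes> a) \<otimes> x \<otimes> inv (b \<otimes> a)"
      using c by (simp add: inv_mult_group m_assoc)
    finally show ?thesis .
  qed
  define Z where "Z = {z \<in> carrier G. \<forall>x \<in> carrier G. z \<otimes> x = x \<otimes> z}"
  have "subgroup Z G"
  proof (rule subgroupI)
    show "Z \<subseteq> carrier G" "Z \<noteq> {}" by (auto simp: Z_def)
  next
    fix a assume a: "a \<in> Z"
    have "inv a \<otimes> x = x \<otimes> inv a" if x: "x \<in> carrier G" for x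
    proof -
      have ac: "a \<in> carrier G" and eq: "a \<otimes> x = x \<otimes> a" using a x by (auto simp: Z_def)
      have "inv a \<otimes> x = inv a \<otimes> (x \<otimes> a) \<otimes> inv a" using ac x by (simp add: m_assoc)
      also have "\<dots> = x \<otimes> inv a" unfolding eq[symmetric] using ac x by (simp add: m_assoc)
      finally show ?thesis .
    qed
    then show "inv a \<in> Z" using a by (auto simp: Z_def)
  next
    fix a b assume ab: "a \<in> Z" "b \<in> Z"
    have "a \<otimes> b \<otimes> x = x \<otimes> (a \<otimes> b)" if x: "x \<in> carrier G" for x
    proof -
      have c: "a \<in> carrier G" "b \<in> carrier G" and eq: "a \<otimes> x = x \<otimes> a" "b \<otimes> x = x \<otimes> b"
        using ab x by (auto simp: Z_def)
      have "a \<otimes> b \<otimes> x = a \<otimes> x \<otimes> b" using c x by (simp add: m_assoc eq(2))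
      also have "\<dots> = x \<otimes> (a \<otimes> b)" using c x by (simp add: m_assoc eq(1))
      finally show ?thesis .
    qed
    then show "a \<otimes> b \<in> Z" using ab m_closed unfolding Z_def by blast
  qed
  moreover have "commutator a b \<in> Z" if c: "a \<in> carrier G" "b \<in> carrier G" for a b
  proof -
    have "commutator a b \<otimes> x = x \<otimes> commutator a b" if x: "x \<in> carrier G" for x
    proof -
      \<comment> \<open>With \<open>[a, b] = (a b) (b a)^-1\<close>, the conjugate of
        \<open>x\<close> by \<open>(b a)^-1\<close> is exposed; by \<open>swap\<close>, conjugating
        it by \<open>a b\<close> returns \<open>x\<close> just as conjugating by \<open>b a\<close>
        does.\<close>
      have "commutator a b \<otimes> x = (a \<otimes> b) \<otimes> (inv (b \<otimes> a) \<otimes> x \<otimes> (b \<otimes> a)) \<otimes> inv (a \<otimes> b) \<otimes> commutator a b"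
        using c x by (simp add: inv_mult_group m_assoc)
      also have "\<dots> = x \<otimes> commutator a b"
        using c x swap[OF c, of "inv (b \<otimes> a) \<otimes> x \<otimes> (b \<otimes> a)"] by (simp add: inv_mult_group m_assoc)
      finally show ?thesis .
    qed
    moreover have "commutator a b \<in> carrier G" using c by simp
    ultimately show ?thesis unfolding Z_def by blast
  qed
  ultimately have "derived G (carrier G) \<subseteq> Z"
    unfolding derived_def by (intro generate_subgroup_incl) auto
  moreover have "commutator a b = \<one>" if "a \<in> Z" "b \<in> Z" for a b
  proof -
    have c: "a \<in> carrier G" "b \<in> carrier G" and eq: "a \<otimes> b = b \<otimes> a"
      using that unfolding Z_def by blast+
    show ?thesis unfolding eq using c by (simp add: m_assoc)
  qed
  ultimately have "derived_set G (derived G (carrier G)) \<subseteq> {\<one>}" by blast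
  then have "derived G (derived G (carrier G)) \<subseteq> {\<one>}"
    unfolding derived_def[of G "derived G (carrier G)"]
    by (rule generate_subgroup_incl[OF _ triv_subgroup])
  moreover have "\<one> \<in> derived G (derived G (carrier G))"
    unfolding derived_def by (rule generate.one)
  ultimately show ?thesis by blast
qed

text \<open>Cyclic subgroups of \<open>K/H\<close> have preimages between \<open>H\<close> and
  \<open>K\<close>. These are normal in \<open>K\<close> by hypothesis, so the preceding lemma
  applies to \<open>K/H\<close>.\<close>

lemma derived_derived_subset_if_overgroups_normal:
  assumes K: "subgroup K G" and H: "subgroup H G" "H \<subseteq> K"
    and norm: "\<And>T g. subgroup T G \<Longrightarrow> H \<subseteq> T \<Longrightarrow> T \<subseteq> K \<Longrightarrow> g \<in> K \<Longrightarrow> conj_by g T = T"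
  shows "derived G (derived G K) \<subseteq> H"
proof -
  interpret K: group "G\<lparr>carrier := K\<rparr>" by (rule subgroup_imp_group[OF K])
  note inv_eq = m_inv_consistent[OF K]
  have "H \<lhd> G\<lparr>carrier := K\<rparr>"
    unfolding K.normal_inv_iff
  proof (intro conjI ballI)
    show "subgroup H (G\<lparr>carrier := K\<rparr>)" by (rule subgroup_incl[OF H(1) K H(2)])
    fix g h assume "g \<in> carrier (G\<lparr>carrier := K\<rparr>)" "h \<in> H"
    then show "g \<otimes>\<^bsub>G\<lparr>carrier := K\<rparr>\<^esub> h \<otimes>\<^bsub>G\<lparr>carrier := K\<rparr>\<^esub> inv\<^bsub>G\<lparr>carrier := K\<rparr>\<^esub> g \<in> H"
      using norm[OF H(1) order_refl H(2), of g] inv_eq[of g] by (auto simp: conj_by_def)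
  qed
  then interpret H: normal H "G\<lparr>carrier := K\<rparr>" .
  let ?Q = "G\<lparr>carrier := K\<rparr> Mod H"
  let ?pi = "\<lambda>a. H #>\<^bsub>G\<lparr>carrier := K\<rparr>\<^esub> a"
  interpret pi: group_hom "G\<lparr>carrier := K\<rparr>" ?Q ?pi by (rule H.group_hom_Mod)
  have "p \<otimes>\<^bsub>?Q\<^esub> q \<otimes>\<^bsub>?Q\<^esub> inv\<^bsub>?Q\<^esub> p \<in> generate ?Q {q}" if pq: "p \<in> carrier ?Q" "q \<in> carrier ?Q" for p q
  proof -
    obtain g x where g: "g \<in> K" "p = ?pi g" and x: "x \<in> K" "q = ?pi x"
      using pq unfolding H.img_Mod[symmetric] by auto
    have cyc: "subgroup (generate ?Q {q}) ?Q" using pi.H.generate_is_subgroup pq by blast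
    define T where "T = {y \<in> carrier (G\<lparr>carrier := K\<rparr>). ?pi y \<in> generate ?Q {q}}"
    have T: "subgroup T G" unfolding T_def by (rule incl_subgroup[OF K pi.subgroup_preimage[OF cyc]])
    have "H \<subseteq> T"
    proof
      fix y assume y: "y \<in> H"
      then have "?pi y = \<one>\<^bsub>?Q\<^esub>" using H.r_coset_eq_one_Mod_iff[of y] H(2) by auto
      then show "y \<in> T" using y H(2) subgroup.one_closed[OF cyc] by (auto simp: T_def)
    qed
    moreover have "T \<subseteq> K" by (auto simp: T_def)
    ultimately have "conj_by g T = T" using norm[OF T] g by blast
    moreover have "x \<in> T" using x by (auto simp: T_def intro: generate.incl)
    ultimately have "g \<otimes> x \<otimes> inv g \<in> T" by (auto simp: conj_by_def)
    then have "?pi (g \<otimes>\<^bsub>G\<lparr>carrier := K\<rparr>\<^esub> x \<otimes>\<^bsub>G\<lparr>carrier := K\<rparr>\<^esub> inv\<^bsub>G\<lparr>carrier := K\<rparr>\<^esub> g) \<in> generate ?Q {q}"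
      using inv_eq[OF g(1)] by (simp add: T_def)
    moreover have "g \<in> carrier (G\<lparr>carrier := K\<rparr>)" "x \<in> carrier (G\<lparr>carrier := K\<rparr>)" using g x by auto
    ultimately show ?thesis
      unfolding g(2) x(2) by (metis K.inv_closed K.m_closed pi.hom_inv pi.hom_mult)
  qed
  then have triv: "derived ?Q (derived ?Q (carrier ?Q)) = {\<one>\<^bsub>?Q\<^esub>}"
    by (rule pi.H.derived_derived_trivial_if_cyclic_normal)
  have dK: "derived G K \<subseteq> K" by (rule derived_incl[OF order_refl K])
  have ddK: "derived G (derived G K) \<subseteq> K" by (rule derived_incl[OF dK K])
  have "derived ?Q (derived ?Q (carrier ?Q)) = ?pi ` derived G (derived G K)"
    unfolding H.img_Mod[symmetric]
    using pi.derived_img[of K] pi.derived_img[of "derived G K"] dK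
      derived_consistent[OF order_refl K] derived_consistent[OF dK K] by simp
  then have "?pi y = \<one>\<^bsub>?Q\<^esub>" if "y \<in> derived G (derived G K)" for y using that triv by blast
  then show ?thesis using H.r_coset_eq_one_Mod_iff ddK by (auto simp: subset_iff)
qed

text \<open>An intersection of normalizers, and normal because conjugation maps \<open>Fam\<close>
  into itself: \<open>T\<close> is moved back by \<open>inv x\<close>, fixed by \<open>g\<close>,
  and moved forward by \<open>x\<close>.\<close>

lemma kernel_of_conjugation_normal:
  assumes XG: "\<And>T. T \<in> Fam \<Longrightarrow> T \<subseteq> carrier G"
    and Fam: "\<And>T g. T \<in> Fam \<Longrightarrow> g \<in> carrier G \<Longrightarrow> conj_by g T \<in> Fam"
  shows "{g \<in> carrier G. \<forall>T \<in> Fam. conj_by g T = T} \<lhd> G" (is "?K \<lhd> G")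
  unfolding normal_inv_iff
proof (intro conjI ballI)
  have "?K = carrier G \<inter> (\<Inter>T \<in> Fam. normalizer_of T)" by (auto simp: normalizer_of_def)
  \<comment> \<open>Inserting \<open>carrier G\<close> covers the case of empty \<open>Fam\<close>,
    whose intersection would be the whole type.\<close>
  also have "\<dots> = \<Inter>(insert (carrier G) (normalizer_of ` Fam))" by auto
  also have "subgroup \<dots> G"
    by (rule subgroups_Inter) (use normalizer_of_subgroup[OF XG] subgroup_self in auto)
  finally show "subgroup ?K G" .
  fix x g assume x: "x \<in> carrier G" and g: "g \<in> ?K"
  have "conj_by (x \<otimes> g \<otimes> inv x) T = T" if T: "T \<in> Fam" for T
  proof -
    have T': "conj_by (inv x) T \<in> Fam" using Fam T x by simp
    have "conj_by (x \<otimes> g \<otimes> inv x) T = conj_by x (conj_by g (conj_by (inv x) T))"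
      using x g XG[OF T] XG[OF T'] by (simp add: conj_by_conj_by m_assoc)
    also have "\<dots> = T" using g T' conj_by_inv(2)[OF x XG[OF T]] by simp
    finally show ?thesis .
  qed
  then show "x \<otimes> g \<otimes> inv x \<in> ?K" using x g by simp
qed

text \<open>The cosets of the kernel correspond to the permutations of \<open>Fam\<close> induced by
  conjugation, and there are \<open>fact (card Fam)\<close> permutations in all.\<close>

lemma kernel_of_conjugation_index:
  assumes XG: "\<And>T. T \<in> Fam \<Longrightarrow> T \<subseteq> carrier G"
    and Fam: "\<And>T g. T \<in> Fam \<Longrightarrow> g \<in> carrier G \<Longrightarrow> conj_by g T \<in> Fam"
    and fin: "finite Fam"
  defines "K \<equiv> {g \<in> carrier G. \<forall>T \<in> Fam. conj_by g T = T}"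
  shows "finite (rcosets K) \<and> card (rcosets K) \<le> fact (card Fam)"
proof -
  \<comment> \<open>The inverse matches right cosets, as in the count of conjugates; outside
    \<open>Fam\<close> the map is the identity, as \<open>permutes\<close> demands.\<close>
  define f where "f = (\<lambda>x T. if T \<in> Fam then conj_by (inv x) T else T)"
  have K: "subgroup K G"
    unfolding K_def by (intro normal_imp_subgroup kernel_of_conjugation_normal XG Fam)
  have perm: "f x permutes Fam" if x: "x \<in> carrier G" for x
  proof (rule bij_imp_permutes)
    have "bij_betw (conj_by (inv x)) Fam Fam"
      by (rule bij_betw_byWitness[of _ "conj_by x"]) (use x XG Fam conj_by_inv in auto)
    then show "bij_betw (f x) Fam Fam" by (rule bij_betw_cong[THEN iffD1, rotated]) (simp add: f_def)
  qed (simp add: f_def)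
  have fibres: "K #> x = K #> y \<longleftrightarrow> f x = f y" if xy: "x \<in> carrier G" "y \<in> carrier G" for x y
  proof -
    have "K #> x = K #> y \<longleftrightarrow> y \<otimes> inv x \<in> K"
      using subgroup.rcos_module[OF K is_group xy(1), of y] xy K
      by (metis repr_independence repr_independenceD rcos_self)
    also have "\<dots> \<longleftrightarrow> (\<forall>T \<in> Fam. conj_by y (conj_by (inv x) T) = T)"
      using xy XG by (simp add: K_def conj_by_conj_by)
    also have "\<dots> \<longleftrightarrow> (\<forall>T \<in> Fam. conj_by (inv x) T = conj_by (inv y) T)"
    proof (rule ball_cong[OF refl])
      fix T assume T: "T \<in> Fam"
      have "conj_by (inv x) T \<in> Fam" using Fam[OF T] xy by simp
      then show "conj_by y (conj_by (inv x) T) = T \<longleftrightarrow> conj_by (inv x) T = conj_by (inv y) T"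
        using conj_by_inv[OF xy(2) XG[OF T]] conj_by_inv(1)[OF xy(2) XG] by metis
    qed
    also have "\<dots> \<longleftrightarrow> f x = f y" by (auto simp: f_def fun_eq_iff)
    finally show ?thesis .
  qed
  have cosets: "rcosets K = (\<lambda>x. K #> x) ` carrier G" by (auto simp: RCOSETS_def)
  obtain \<beta> where \<beta>: "bij_betw \<beta> (rcosets K) (f ` carrier G)"
    unfolding cosets
    using ex_bij_betw_images_same_fibres[of "carrier G" "\<lambda>x. K #> x" f] fibres by auto
  have sub: "f ` carrier G \<subseteq> {p. p permutes Fam}" using perm by auto
  note finp = finite_permutations[OF fin]
  have "finite (rcosets K)" using bij_betw_finite[OF \<beta>] finite_subset[OF sub finp] by simp
  moreover have "card (rcosets K) \<le> fact (card Fam)"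
    using bij_betw_same_card[OF \<beta>] card_mono[OF finp sub] card_permutations[OF refl fin] by simp
  ultimately show ?thesis by blast
qed

end

section \<open>The kernel of conjugation: index and derived length\<close>

theorem theoremA:
  fixes G :: "('a, 'b) monoid_scheme" and m n :: nat
  assumes "group G"
    and "locally_graded G"
    and "finite {H. subgroup H G \<and> \<not> nilpotent_class_le G H n}"
    and "card {H. subgroup H G \<and> \<not> nilpotent_class_le G H n} = m"
  shows "\<exists>S. S \<lhd> G
           \<and> ((derived G) ^^ nat (\<lfloor>log 2 (real n)\<rfloor> + int m + 3)) S = {\<one>\<^bsub>G\<^esub>}
           \<and> finite (carrier (G Mod S))
           \<and> card (carrier (G Mod S)) \<le> fact m"
proof -
  interpret group G by fact
  define Fam where "Fam = {H. subgroup H G \<and> \<not> nilpotent_class_le G H n}"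
  define K where "K = {g \<in> carrier G. \<forall>T \<in> Fam. conj_by g T = T}"
  \<comment> \<open>Chosen so that \<open>n < 2 ^ k\<close>; thus \<open>k\<close> bounds the
    derived length of every subgroup nilpotent of class at most \<open>n\<close>.\<close>
  define k where "k = Suc (nat \<lfloor>log 2 (real n)\<rfloor>)"
  have Xc: "T \<subseteq> carrier G" if "T \<in> Fam" for T
    using that subgroup.subset by (auto simp: Fam_def)
  have Xconj: "conj_by g T \<in> Fam" if "T \<in> Fam" "g \<in> carrier G" for T g
    using that conj_by_subgroup nilpotent_class_le_conj_by_iff by (auto simp: Fam_def)
  have "K \<lhd> G" unfolding K_def by (rule kernel_of_conjugation_normal[OF Xc Xconj])
  then have K: "subgroup K G" by (rule normal_imp_subgroup)
  have "finite (rcosets\<^bsub>G\<^esub> K) \<and> card (rcosets\<^bsub>G\<^esub> K) \<le> fact m"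
    using kernel_of_conjugation_index[OF Xc Xconj] assms(3,4) unfolding K_def Fam_def by blast
  then have index: "finite (carrier (G Mod K))" "card (carrier (G Mod K)) \<le> fact m"
    by (simp_all add: FactGroup_def)
  have lt: "n < 2 ^ k"
  proof (cases "n = 0")
    case False
    then have "real n = 2 powr (log 2 (real n))" by simp
    also have "\<dots> < 2 powr (real k)"
      using False by (intro powr_less_mono) (simp_all add: k_def, linarith)
    also have "\<dots> = real (2 ^ k)" by (simp add: powr_realpow)
    finally show ?thesis by (simp only: of_nat_less_iff)
  qed simp
  \<comment> \<open>This includes \<open>n = 0\<close>, where \<open>log 2 0 = 0\<close>.\<close>
  have log0: "\<lfloor>log 2 (real n)\<rfloor> \<ge> 0" by (cases "n = 0") (simp_all add: log_def)
  have len: "nat (\<lfloor>log 2 (real n)\<rfloor> + int m + 3) = k + m + 2"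
    unfolding k_def using log0 by linarith
  have "(derived G ^^ (k + m + 2)) K = {\<one>\<^bsub>G\<^esub>}"
  proof (cases "nilpotent_class_le G K n")
    case True
    show ?thesis
      by (rule exp_of_derived_trivial[OF K nilpotent_exp_of_derived[OF K True lt]]) simp
  next
    case False
    have "K \<in> Fam" using False K by (simp add: Fam_def)
    \<comment> \<open>\<open>K\<close> itself is counted by \<open>m\<close>. This makes
      \<open>k + 3 \<le> k + m + 2\<close>, exactly what the length found below requires.\<close>
    then have m: "m \<ge> 1"
      using assms(3,4) unfolding Fam_def[symmetric] by (metis One_nat_def Suc_leI card_gt_0_iff empty_iff)
    obtain H where H: "H \<in> Fam" "H \<subseteq> K" "\<And>P. P \<in> Fam \<Longrightarrow> P \<subseteq> H \<Longrightarrow> P = H"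
      using finite_has_minimal2[of Fam K] assms(3) \<open>K \<in> Fam\<close> unfolding Fam_def[symmetric] by metis
    have sH: "subgroup H G" "\<not> nilpotent_class_le G H n" using H(1) by (auto simp: Fam_def)
    have "nilpotent_class_le G P n" if "subgroup P G" "P \<subset> H" for P
      using H(3)[of P] that by (auto simp: Fam_def)
    then obtain M where M: "subgroup M G" "nilpotent_class_le G M n" "derived G H \<subseteq> M"
      using minimal_non_nilpotent_derived[OF assms(2) sH] by blast
    have "derived G (derived G K) \<subseteq> H"
    proof (rule derived_derived_subset_if_overgroups_normal[OF K sH(1) H(2)])
      fix T g assume T: "subgroup T G" "H \<subseteq> T" "g \<in> K"
      \<comment> \<open>The class bound passes to subgroups, so every overgroup of \<open>H\<close>
        violates it too and is fixed by \<open>K\<close>.\<close>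
      have "T \<in> Fam" using T sH nilpotent_class_le_subgroup by (auto simp: Fam_def)
      then show "conj_by g T = T" using T(3) by (simp add: K_def)
    qed
    then have "derived G (derived G (derived G K)) \<subseteq> M"
      using mono_derived M(3) by blast
    \<comment> \<open>The length adds up as two steps from \<open>K\<close> into \<open>H\<close>,
      one from \<open>H\<close> into \<open>M\<close>, and \<open>k\<close> within
      \<open>M\<close>.\<close>
    then have "(derived G ^^ k) ((derived G ^^ 3) K) \<subseteq> (derived G ^^ k) M"
      by (intro mono_exp_of_derived) (simp add: numeral_3_eq_3)
    then have "(derived G ^^ (k + 3)) K \<subseteq> {\<one>\<^bsub>G\<^esub>}"
      using nilpotent_exp_of_derived[OF M(1,2) lt] by (simp only: funpow_add comp_apply)
    then show ?thesis by (rule exp_of_derived_trivial[OF K]) (use m in simp)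
  qed
  then show ?thesis using \<open>K \<lhd> G\<close> index len by auto
qed

end
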